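(* Let $B$ be a nonempty set of sets, partially ordered by inclusion, and let $X_1\subset X_2$ be elements of $B$. Then there exist $Y_1,Y_2\in B$ which are immediate neighbors in $B$ with $X_1\subseteq Y_1\subset Y_2\subseteq X_2$ if and only if there exist $y\in X_2\setminus X_1$ and a maximal chain $C\subseteq B$ between $X_1$ and $X_2$ such that $\bigcup_{X\in C,\ y\notin X}X\in B$ and $\bigcap_{X\in C,\ y\in X}X\in B$.
   Context: $\subset$ denotes proper inclusion. In a poset $S$, $a,b$ are immediate neighbors if $a<b$ and there is no $c\in S$ with $a<c<b$. A chain $C\subseteq S$ is a maximal chain between $a$ and $b$ if $a$ is the smallest member of $C$, $b$ is the greatest member of $C$, and for any $x\in S\setminus C$ with $a<x<b$, $C\cup\{x\}$ is not a chain. *)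

theory Defs
  imports Main
begin

text \<open>
  A poset is given by a carrier set inside a type of class \<open>order\<close>; for families of sets the
  order is inclusion.
\<close>

definition immediate_neighbors :: "'a::order set \<Rightarrow> 'a \<Rightarrow> 'a \<Rightarrow> bool" where
  "immediate_neighbors S a b \<longleftrightarrow>
     a \<in> S \<and> b \<in> S \<and> a < b \<and> \<not> (\<exists>c\<in>S. a < c \<and> c < b)"

definition maximal_chain_between :: "'a::order set \<Rightarrow> 'a \<Rightarrow> 'a \<Rightarrow> 'a set \<Rightarrow> bool" where
  "maximal_chain_between S a b C \<longleftrightarrow>
     C \<subseteq> S \<and> Complete_Partial_Order.chain (\<le>) C \<and>
     a \<in> C \<and> (\<forall>x\<in>C. a \<le> x) \<and>
     b \<in> C \<and> (\<forall>x\<in>C. x \<le> b) \<and>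
     (\<forall>x\<in>S - C. a < x \<and> x < b \<longrightarrow> \<not> Complete_Partial_Order.chain (\<le>) (C \<union> {x}))"

end

theory Submission imports Defs begin

text \<open>
  If Y1 and Y2 are immediate neighbors, every member of a chain through both is contained in Y1 or
  contains Y2; so for y in Y2 but not in Y1, and C any maximal chain through Y1 and Y2,
  the union and the intersection in question are Y1 and Y2.
  Conversely, that union and that intersection are comparable to every member of C, and so is
  everything strictly between them; by maximality of C there is nothing of B strictly between.
\<close>

text \<open>Zorn's lemma, applied to the chains in \<open>S \<inter> {a..b}\<close> that contain
  \<open>D\<close> and both endpoints.\<close>

lemma chain_extends_to_maximal_chain_between:
  fixes S :: "'a::order set"
  assumes "a \<in> S" "b \<in> S" "a \<le> b"
    and "D \<subseteq> S \<inter> {a..b}" "Complete_Partial_Order.chain (\<le>) D"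
  obtains C where "D \<subseteq> C" "maximal_chain_between S a b C"
proof -
  \<comment> \<open>Forcing \<open>a\<close> and \<open>b\<close> into every member, inside
    \<open>{a..b}\<close>, makes them the least and greatest elements of the chain that Zorn's lemma
    yields.\<close>
  define A where "A = {C. C \<subseteq> S \<inter> {a..b} \<and> Complete_Partial_Order.chain (\<le>) C \<and> insert a (insert b D) \<subseteq> C}"
  have "Complete_Partial_Order.chain (\<le>) (insert a (insert b D))"
    using assms unfolding chain_def by (auto simp: subset_iff)
  then have "insert a (insert b D) \<in> A"
    using assms by (auto simp: A_def)
  then have "A \<noteq> {}" by blast
  moreover have "\<Union>\<C> \<in> A" if "\<C> \<noteq> {}" and "subset.chain A \<C>" for \<C>
  proof -
    have sub: "\<C> \<subseteq> A" and tot: "\<And>P Q. P \<in> \<C> \<Longrightarrow> Q \<in> \<C> \<Longrightarrow> P \<subseteq> Q \<or> Q \<subseteq> P"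
      using that(2) unfolding subset_chain_def by auto
    have "x \<le> y \<or> y \<le> x" if mem: "x \<in> P" "P \<in> \<C>" "y \<in> Q" "Q \<in> \<C>" for x y P Q
    proof -
      \<comment> \<open>\<open>R\<close> is the larger of \<open>P\<close> and
        \<open>Q\<close>.\<close>
      obtain R where "R \<in> \<C>" "x \<in> R" "y \<in> R"
        using tot[of P Q] mem by blast
      moreover from this have "Complete_Partial_Order.chain (\<le>) R"
        using sub by (auto simp: A_def)
      ultimately show ?thesis by (blast dest: chainD)
    qed
    then have "Complete_Partial_Order.chain (\<le>) (\<Union>\<C>)"
      by (intro chainI) blast
    moreover have "insert a (insert b D) \<subseteq> \<Union>\<C>"
      using that(1) sub unfolding A_def by blast
    moreover have "\<Union>\<C> \<subseteq> S \<inter> {a..b}"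
      using sub unfolding A_def by blast
    ultimately show ?thesis by (simp add: A_def)
  qed
  ultimately obtain C where C: "C \<in> A" and max: "\<And>E. E \<in> A \<Longrightarrow> C \<subseteq> E \<Longrightarrow> E = C"
    using subset_Zorn_nonempty[of A] by blast
  have "\<not> Complete_Partial_Order.chain (\<le>) (C \<union> {x})" if "x \<in> S - C" "a < x" "x < b" for x
  proof
    assume "Complete_Partial_Order.chain (\<le>) (C \<union> {x})"
    then have "C \<union> {x} \<in> A"
      using C that by (auto simp: A_def)
    then show False using max that(1) by blast
  qed
  with C have "maximal_chain_between S a b C"
    unfolding maximal_chain_between_def A_def by auto
  with C that show thesis by (auto simp: A_def)
qed

text \<open>The point \<open>y\<close> separates \<open>Y1\<close> from \<open>Y2\<close>, so the
  members of \<open>C\<close> omitting \<open>y\<close> are those contained in \<open>Y1\<close>,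
  and the members having \<open>y\<close> are those containing \<open>Y2\<close>. Both extremes are
  attained, by \<open>Y1\<close> and \<open>Y2\<close> themselves.\<close>

lemma Union_Inter_at_immediate_neighbors:
  assumes nb: "immediate_neighbors B Y1 Y2" and "C \<subseteq> B" "Complete_Partial_Order.chain (\<le>) C"
    and "Y1 \<in> C" "Y2 \<in> C" "y \<in> Y2 - Y1"
  shows "\<Union>{X \<in> C. y \<notin> X} = Y1" and "\<Inter>{X \<in> C. y \<in> X} = Y2"
proof -
  \<comment> \<open>Otherwise comparability with \<open>Y1\<close> and \<open>Y2\<close> would put
    \<open>X\<close> strictly between them.\<close>
  have "X \<subseteq> Y1 \<or> Y2 \<subseteq> X" if "X \<in> C" for X
    using that assms chainD[of "(\<le>)" C X Y1] chainD[of "(\<le>)" C X Y2]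
    unfolding immediate_neighbors_def by (blast intro: psubsetI)
  then show "\<Union>{X \<in> C. y \<notin> X} = Y1" and "\<Inter>{X \<in> C. y \<in> X} = Y2"
    using assms(4-6) by blast+
qed

text \<open>Membership of \<open>y\<close> cuts \<open>C\<close> into a lower and an upper part; an
  element of \<open>B\<close> strictly inside the gap could be added to \<open>C\<close>.\<close>

lemma immediate_neighbors_Union_Inter:
  assumes C: "maximal_chain_between B X1 X2 C" and y: "y \<in> X2 - X1"
    and "\<Union>{X \<in> C. y \<notin> X} \<in> B" "\<Inter>{X \<in> C. y \<in> X} \<in> B"
  shows "immediate_neighbors B (\<Union>{X \<in> C. y \<notin> X}) (\<Inter>{X \<in> C. y \<in> X})"
proof -
  let ?U = "\<Union>{X \<in> C. y \<notin> X}" and ?I = "\<Inter>{X \<in> C. y \<in> X}"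
  have ch: "Complete_Partial_Order.chain (\<le>) C" and ends: "X1 \<in> C" "X2 \<in> C"
    and max: "\<And>Z. Z \<in> B - C \<Longrightarrow> X1 \<subset> Z \<Longrightarrow> Z \<subset> X2 \<Longrightarrow> \<not> Complete_Partial_Order.chain (\<le>) (C \<union> {Z})"
    using C unfolding maximal_chain_between_def by auto
  \<comment> \<open>A set having \<open>y\<close> is not contained in one omitting \<open>y\<close>,
    so comparability in \<open>C\<close> leaves only the other inclusion.\<close>
  have "?U \<subseteq> ?I"
    using chainD[OF ch] by blast
  moreover have "y \<in> ?I - ?U" by blast
  ultimately have "?U \<subset> ?I" by blast
  moreover have False if "Z \<in> B" "?U \<subset> Z" "Z \<subset> ?I" for Z
  proof -
    \<comment> \<open>If \<open>y \<notin> X\<close>, then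
      \<open>X \<subseteq> ?U \<subset> Z\<close>; if \<open>y \<in> X\<close>, then
      \<open>Z \<subset> ?I \<subseteq> X\<close>. Strictness is what rules out
      \<open>Z \<in> C\<close>.\<close>
    have cmp: "X \<subset> Z \<or> Z \<subset> X" if "X \<in> C" for X
      using that \<open>?U \<subset> Z\<close> \<open>Z \<subset> ?I\<close> by blast
    then have "Z \<notin> C" by blast
    moreover have "X1 \<subset> Z" "Z \<subset> X2"
      using that ends y by blast+
    moreover have "Complete_Partial_Order.chain (\<le>) (C \<union> {Z})"
      using ch cmp unfolding chain_def by blast
    ultimately show False using max \<open>Z \<in> B\<close> by blast
  qed
  ultimately show ?thesis
    using assms(3,4) unfolding immediate_neighbors_def by metis
qed

theorem lemma2p1:
  fixes B :: "'a set set" and X1 X2 :: "'a set"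
  assumes "B \<noteq> {}"
    and "X1 \<in> B" and "X2 \<in> B" and "X1 \<subset> X2"
  shows "(\<exists>Y1\<in>B. \<exists>Y2\<in>B. immediate_neighbors B Y1 Y2 \<and> X1 \<subseteq> Y1 \<and> Y1 \<subset> Y2 \<and> Y2 \<subseteq> X2)
     \<longleftrightarrow> (\<exists>y\<in>X2 - X1. \<exists>C. maximal_chain_between B X1 X2 C \<and>
            \<Union>{X \<in> C. y \<notin> X} \<in> B \<and> \<Inter>{X \<in> C. y \<in> X} \<in> B)"
    (is "?L \<longleftrightarrow> ?R")
proof
  assume ?L
  then obtain Y1 Y2 where Y: "Y1 \<in> B" "Y2 \<in> B" "immediate_neighbors B Y1 Y2"
    "X1 \<subseteq> Y1" "Y1 \<subset> Y2" "Y2 \<subseteq> X2" by blast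
  then obtain y where y: "y \<in> Y2 - Y1" by blast
  have "Complete_Partial_Order.chain (\<le>) {Y1, Y2}"
    using Y unfolding chain_def by blast
  moreover have "{Y1, Y2} \<subseteq> B \<inter> {X1..X2}"
    using Y by auto
  ultimately obtain C where C: "{Y1, Y2} \<subseteq> C" "maximal_chain_between B X1 X2 C"
    using chain_extends_to_maximal_chain_between[of X1 B X2] assms by blast
  then have "C \<subseteq> B" "Complete_Partial_Order.chain (\<le>) C"
    unfolding maximal_chain_between_def by auto
  then have "\<Union>{X \<in> C. y \<notin> X} = Y1" "\<Inter>{X \<in> C. y \<in> X} = Y2"
    using Union_Inter_at_immediate_neighbors[OF Y(3)] C(1) y by simp_all
  then show ?R
    \<comment> \<open>The same \<open>y\<close> serves for the outer pair, since
      \<open>Y2 - Y1 \<subseteq> X2 - X1\<close>.\<close>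
    using C(2) Y y by (intro bexI[of _ y] exI[of _ C]) auto
next
  assume ?R
  then obtain y C where y: "y \<in> X2 - X1" and C: "maximal_chain_between B X1 X2 C"
    and B: "\<Union>{X \<in> C. y \<notin> X} \<in> B" "\<Inter>{X \<in> C. y \<in> X} \<in> B" by blast
  have nb: "immediate_neighbors B (\<Union>{X \<in> C. y \<notin> X}) (\<Inter>{X \<in> C. y \<in> X})"
    using immediate_neighbors_Union_Inter[OF C y B] .
  have "X1 \<in> C" "X2 \<in> C"
    using C unfolding maximal_chain_between_def by auto
  then have "X1 \<subseteq> \<Union>{X \<in> C. y \<notin> X}" "\<Inter>{X \<in> C. y \<in> X} \<subseteq> X2"
    using y by blast+
  moreover have "\<Union>{X \<in> C. y \<notin> X} \<subset> \<Inter>{X \<in> C. y \<in> X}"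
    using nb unfolding immediate_neighbors_def by simp
  ultimately show ?L
    using nb B by metis
qed

end
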